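(* Suppose that $A$ and $B$ are compact, Ahlfors-David regular, Borel subsets of $\mathbb{R}^d$, $d\ge 2$, of Hausdorff dimension $s_A$ and $s_B$ respectively, which satisfy $s_A+s_B\ge d$. Let $s$ be a local $C^\infty$ diffeomorphism of $\mathbb{R}^d$. Let $\lambda(x)$ denote the lower Minkowski dimension of $A\cap(s(x)-B)$, and let $N(x,\epsilon)$ be the minimum number of open $\epsilon$-balls needed to cover $A\cap(s(x)-B)$. Then for any smooth compactly supported function $\psi$ and every $\epsilon>0$, there exists a constant $C$, which is independent of $\epsilon$ and depends only on $\psi$ and $s$, such that $$\int N(x,\epsilon)\,\psi(x)\,dx\le C\,(\epsilon^{-1})^{s_A+s_B-d},$$ from which it follows that $$\lambda(x)\le s_A+s_B-d$$ for almost every $x\in\mathbb{R}^d$ (with respect to Lebesgue measure).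
   Context: A Borel set $E\subset\mathbb{R}^d$ of Hausdorff dimension $s_E$ is Ahlfors-David regular if there is $C>0$ such that $C^{-1}\delta^{s_E}\le\mu(B(x,\delta))\le C\delta^{s_E}$ for all $x\in E$ and all $0<\delta<\mathrm{diam}(E)$, where $\mu$ is the ($s_E$-dimensional) Hausdorff measure restricted to $E$ and $B(x,\delta)$ is the ball of radius $\delta$ centered at $x$. For $z\in\mathbb{R}^d$, $z-B=\{z-b:b\in B\}$. The lower Minkowski dimension of a nonempty bounded set $E$ is $\liminf_{\epsilon\downarrow 0}\frac{\log N_E(\epsilon)}{\log(1/\epsilon)}$, where $N_E(\epsilon)$ is the minimum number of open $\epsilon$-balls needed to cover $E$; the empty set needs $0$ balls and is assigned dimension $0$.
   Formalization: The bound is proved for all 0<ε≤ε₀ with ε₀ arbitrary, where C may depend on ε₀, A and B as well as on ψ and s; one C for all ε>0, or one independent of A and B, is impossible (take A and B closed balls, s the identity). *)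

theory Defs
  imports "HOL-Analysis.Analysis"
begin

section \<open>Smooth maps and local diffeomorphisms\<close>

(* Meant for open S: iterated directional derivatives of order < k are Frechet differentiable on S
   and those of order k are continuous, which is the usual C^k on an open set. *)
primrec Ck_on :: "nat \<Rightarrow> ('a::euclidean_space \<Rightarrow> 'b::real_normed_vector) \<Rightarrow> 'a set \<Rightarrow> bool" where
  "Ck_on 0 f S \<longleftrightarrow> continuous_on S f"
| "Ck_on (Suc k) f S \<longleftrightarrow>
     (\<forall>x\<in>S. f differentiable (at x)) \<and> (\<forall>v. Ck_on k (\<lambda>x. frechet_derivative f (at x) v) S)"

definition smooth_on :: "('a::euclidean_space \<Rightarrow> 'b::real_normed_vector) \<Rightarrow> 'a set \<Rightarrow> bool" where
  "smooth_on f S \<longleftrightarrow> (\<forall>k. Ck_on k f S)"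

definition local_smooth_diffeo :: "('a::euclidean_space \<Rightarrow> 'a) \<Rightarrow> bool" where
  "local_smooth_diffeo f \<longleftrightarrow>
     (\<forall>x. \<exists>U V g. open U \<and> x \<in> U \<and> open V \<and> homeomorphism U V f g \<and>
        smooth_on f U \<and> smooth_on g V)"


section \<open>Hausdorff measure and dimension\<close>

(* diam(U)^s with the conventions diam({})^s = 0 and diam(U)^0 = 1 for nonempty U, so that the
   0-dimensional measure is the counting measure. The case split is needed because 0 powr 0 = 0. *)
definition diam_powr :: "real \<Rightarrow> 'a::metric_space set \<Rightarrow> real" where
  "diam_powr s U = (if U = {} then 0 else if s = 0 then 1 else diameter U powr s)"

(* The library's diameter is only meaningful on bounded sets. *)
definition hausdorff_content :: "real \<Rightarrow> real \<Rightarrow> 'a::metric_space set \<Rightarrow> ennreal" where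
  "hausdorff_content s \<delta> E =
     (INF U \<in> {U :: nat \<Rightarrow> 'a set.
                 E \<subseteq> (\<Union>i. U i) \<and> (\<forall>i. bounded (U i) \<and> diameter (U i) \<le> \<delta>)}.
        \<Sum>i. ennreal (diam_powr s (U i)))"

(* The (unnormalised) s-dimensional Hausdorff outer measure; on Borel sets it is the
   Hausdorff measure. *)
definition hausdorff_measure :: "real \<Rightarrow> 'a::metric_space set \<Rightarrow> ennreal" where
  "hausdorff_measure s E = (SUP \<delta> \<in> {0<..}. hausdorff_content s \<delta> E)"

(* In Euclidean space the set on the right is nonempty and bounded below, so the real infimum
   is the usual one. *)
definition hausdorff_dim :: "'a::euclidean_space set \<Rightarrow> real" where
  "hausdorff_dim E = Inf {s. 0 \<le> s \<and> hausdorff_measure s E = 0}"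

(* An unbounded E has infinite diameter, so then there is no upper limit on \<delta>. *)
definition ahlfors_david_regular :: "'a::euclidean_space set \<Rightarrow> bool" where
  "ahlfors_david_regular E \<longleftrightarrow> E \<in> sets borel \<and>
     (\<exists>C>0. \<forall>x\<in>E. \<forall>\<delta>>0. (bounded E \<longrightarrow> \<delta> < diameter E) \<longrightarrow>
        ennreal (inverse C * \<delta> powr hausdorff_dim E)
          \<le> hausdorff_measure (hausdorff_dim E) (E \<inter> ball x \<delta>) \<and>
        hausdorff_measure (hausdorff_dim E) (E \<inter> ball x \<delta>)
          \<le> ennreal (C * \<delta> powr hausdorff_dim E))"


section \<open>Covering numbers and lower Minkowski dimension\<close>

(* Meant for totally bounded E and \<epsilon> > 0; the centres need not lie in E. *)
definition covering_number :: "'a::metric_space set \<Rightarrow> real \<Rightarrow> nat" where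
  "covering_number E \<epsilon> = (LEAST n. \<exists>P. finite P \<and> card P = n \<and> E \<subseteq> (\<Union>p\<in>P. ball p \<epsilon>))"

definition lower_minkowski_dim :: "'a::metric_space set \<Rightarrow> ereal" where
  "lower_minkowski_dim E =
     (if E = {} then 0
      else Liminf (at_right 0) (\<lambda>\<epsilon>. ereal (ln (real (covering_number E \<epsilon>)) / ln (1 / \<epsilon>))))"

end

theory Submission
  imports Defs
begin

text \<open>
  Cover \<open>A\<close> by about \<open>\<epsilon> powr (- s_A)\<close> balls with centres \<open>p\<close> and \<open>B\<close> by about \<open>\<epsilon> powr (- s_B)\<close> balls
  with centres \<open>q\<close>, all of radius \<open>\<epsilon>\<close>. A ball \<open>ball p \<epsilon>\<close> is needed to cover \<open>A \<inter> (s(x) - B)\<close> only if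
  \<open>s(x)\<close> lies within \<open>2\<epsilon>\<close> of some \<open>p + q\<close>. Since \<open>s\<close> has a locally Lipschitz local inverse, this
  happens for each pair \<open>(p, q)\<close> on a set of \<open>x\<close> of measure \<open>O(\<epsilon> ^ d)\<close> in a compact set, and summing over
  the pairs gives the integral bound. Fatou's lemma along \<open>\<epsilon> = 2 ^ -k\<close> then shows that
  \<open>N(x, \<epsilon>) \<epsilon> powr (s_A + s_B - d)\<close> has finite lower limit for almost every \<open>x\<close>.
\<close>

section \<open>Ball covers of Ahlfors-David regular sets\<close>

lemma hausdorff_content_antimono:
  fixes E :: "'a::metric_space set"
  assumes "\<delta> \<le> \<delta>'"
  shows "hausdorff_content s \<delta>' E \<le> hausdorff_content s \<delta> E"
  unfolding hausdorff_content_def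
proof (rule INF_superset_mono)
  have "diameter S \<le> \<delta>'" if "diameter S \<le> \<delta>" for S :: "'a set"
    using that assms by simp
  then show "{U. E \<subseteq> (\<Union>i. U i) \<and> (\<forall>i. bounded (U i) \<and> diameter (U i) \<le> \<delta>)}
      \<subseteq> {U. E \<subseteq> (\<Union>i. U i) \<and> (\<forall>i. bounded (U i) \<and> diameter (U i) \<le> \<delta>')}" by blast
qed simp

text \<open>Contents grow as the scale shrinks, so the supremum over all scales is a limit along any
  sequence of scales decreasing to 0. Starting the sequence at a prescribed \<open>\<delta>\<close>
  lets content inequalities known only at scales up to \<open>\<delta>\<close> pass to the measure,
  also through finite sums.\<close>

lemma hausdorff_content_LIMSEQ:
  assumes "\<delta> > 0"
  shows "(\<lambda>n. hausdorff_content s (\<delta> / real (Suc n)) E) \<longlonglongrightarrow> hausdorff_measure s E"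
proof -
  have "incseq (\<lambda>n. hausdorff_content s (\<delta> / real (Suc n)) E)"
    using assms by (intro monoI hausdorff_content_antimono divide_left_mono) auto
  then have "(\<lambda>n. hausdorff_content s (\<delta> / real (Suc n)) E)
      \<longlonglongrightarrow> (SUP n. hausdorff_content s (\<delta> / real (Suc n)) E)"
    by (rule LIMSEQ_SUP)
  moreover have "(SUP n. hausdorff_content s (\<delta> / real (Suc n)) E) = hausdorff_measure s E"
    unfolding hausdorff_measure_def
  proof (intro antisym SUP_mono)
    show "\<exists>m\<in>{0<..}. hausdorff_content s (\<delta> / real (Suc n)) E \<le> hausdorff_content s m E" for n
      using assms by (intro bexI[of _ "\<delta> / real (Suc n)"]) auto
    fix r :: real assume "r \<in> {0<..}"
    then have "r / \<delta> > 0" using assms by simp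
    then obtain n where n: "inverse (real (Suc n)) < r / \<delta>"
      using reals_Archimedean by blast
    then have "\<delta> / real (Suc n) \<le> r"
      using assms by (simp add: field_simps)
    then show "\<exists>n\<in>UNIV. hausdorff_content s r E \<le> hausdorff_content s (\<delta> / real (Suc n)) E"
      using hausdorff_content_antimono by blast
  qed
  ultimately show ?thesis by simp
qed

text \<open>A set of diameter at most \<open>\<delta>\<close> meets at most one of the pieces, so a
  cover of \<open>E\<close> splits into covers of the pieces in which no set is charged twice. The
  argument works with outer measures and needs no measurability of the pieces.\<close>

lemma sum_hausdorff_content_separated:
  fixes E :: "'a::metric_space set"
  assumes "finite I" "\<delta> > 0" "\<And>i. i \<in> I \<Longrightarrow> F i \<subseteq> E"
    and sep: "\<And>i j x y. i \<in> I \<Longrightarrow> j \<in> I \<Longrightarrow> i \<noteq> j \<Longrightarrow> x \<in> F i \<Longrightarrow> y \<in> F j \<Longrightarrow> \<delta> < dist x y"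
  shows "(\<Sum>i\<in>I. hausdorff_content s \<delta> (F i)) \<le> hausdorff_content s \<delta> E"
  unfolding hausdorff_content_def[of s \<delta> E]
proof (rule INF_greatest, clarsimp)
  fix U :: "nat \<Rightarrow> 'a set"
  assume cover: "E \<subseteq> (\<Union>k. U k)" and U: "\<forall>k. bounded (U k) \<and> diameter (U k) \<le> \<delta>"
  \<comment> \<open>Sets missing \<open>F i\<close> become empty rather than being removed, which
    keeps the indexing by \<open>nat\<close>. The empty set costs nothing even when
    \<open>s = 0\<close>, by the convention in \<open>diam_powr\<close>.\<close>
  define V where "V i k = (if U k \<inter> F i = {} then {} else U k)" for i k
  have "hausdorff_content s \<delta> (F i) \<le> (\<Sum>k. ennreal (diam_powr s (V i k)))" if i: "i \<in> I" for i
    unfolding hausdorff_content_def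
  proof (rule INF_lower, safe)
    fix x assume "x \<in> F i"
    then obtain k where "x \<in> U k" using cover assms(3)[OF i] by blast
    with \<open>x \<in> F i\<close> show "x \<in> (\<Union>k. V i k)" unfolding V_def by auto
  qed (use U \<open>\<delta> > 0\<close> in \<open>auto simp: V_def\<close>)
  then have "(\<Sum>i\<in>I. hausdorff_content s \<delta> (F i)) \<le> (\<Sum>i\<in>I. \<Sum>k. ennreal (diam_powr s (V i k)))"
    by (rule sum_mono)
  also have "\<dots> = (\<Sum>k. \<Sum>i\<in>I. ennreal (diam_powr s (V i k)))"
    by (simp add: suminf_sum)
  also have "\<dots> \<le> (\<Sum>k. ennreal (diam_powr s (U k)))"
  proof (rule suminf_le)
    fix k
    show "(\<Sum>i\<in>I. ennreal (diam_powr s (V i k))) \<le> ennreal (diam_powr s (U k))"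
    proof (cases "\<exists>i\<in>I. U k \<inter> F i \<noteq> {}")
      case False
      then have "\<forall>i\<in>I. V i k = {}" by (auto simp: V_def)
      then show ?thesis by (simp add: diam_powr_def)
    next
      case True
      then obtain i where i: "i \<in> I" "U k \<inter> F i \<noteq> {}" by auto
      have "V j k = {}" if "j \<in> I - {i}" for j
      proof (rule ccontr)
        assume "V j k \<noteq> {}"
        then obtain x y where xy: "x \<in> U k" "x \<in> F i" "y \<in> U k" "y \<in> F j"
          using i by (auto simp: V_def split: if_splits)
        then have "\<delta> < dist x y" using sep that i by auto
        moreover have "dist x y \<le> diameter (U k)"
          using U xy by (intro diameter_bounded_bound) auto
        moreover have "diameter (U k) \<le> \<delta>" using U by blast
        ultimately show False by linarith
      qed
      then have "(\<Sum>i\<in>I. ennreal (diam_powr s (V i k))) = ennreal (diam_powr s (V i k))"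
        by (subst sum.remove[OF assms(1) i(1)]) (simp add: diam_powr_def)
      then show ?thesis by (simp add: V_def diam_powr_def)
    qed
  qed auto
  finally show "(\<Sum>i\<in>I. hausdorff_content s \<delta> (F i)) \<le> (\<Sum>k. ennreal (diam_powr s (U k)))" .
qed

text \<open>Pieces more than \<open>\<delta>\<close> apart are also more than
  \<open>\<delta> / Suc n\<close> apart, so the inequality for contents holds at every scale of the
  sequence and survives the limit.\<close>

lemma sum_hausdorff_measure_separated:
  fixes E :: "'a::metric_space set"
  assumes "finite I" "\<delta> > 0" "\<And>i. i \<in> I \<Longrightarrow> F i \<subseteq> E"
    and sep: "\<And>i j x y. i \<in> I \<Longrightarrow> j \<in> I \<Longrightarrow> i \<noteq> j \<Longrightarrow> x \<in> F i \<Longrightarrow> y \<in> F j \<Longrightarrow> \<delta> < dist x y"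
  shows "(\<Sum>i\<in>I. hausdorff_measure s (F i)) \<le> hausdorff_measure s E"
proof (rule LIMSEQ_le)
  show "(\<lambda>n. \<Sum>i\<in>I. hausdorff_content s (\<delta> / real (Suc n)) (F i))
      \<longlonglongrightarrow> (\<Sum>i\<in>I. hausdorff_measure s (F i))"
    using assms by (intro tendsto_sum hausdorff_content_LIMSEQ)
  show "(\<lambda>n. hausdorff_content s (\<delta> / real (Suc n)) E) \<longlonglongrightarrow> hausdorff_measure s E"
    using assms by (intro hausdorff_content_LIMSEQ)
  have "\<delta> / real (Suc n) < dist x y" if "\<delta> < dist x y" for n and x y :: 'a
  proof -
    have "\<delta> / real (Suc n) \<le> \<delta>" using \<open>\<delta> > 0\<close> by (simp add: field_simps)
    then show ?thesis using that by (rule le_less_trans)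
  qed
  then have "(\<Sum>i\<in>I. hausdorff_content s (\<delta> / real (Suc n)) (F i))
      \<le> hausdorff_content s (\<delta> / real (Suc n)) E" for n
    using assms by (intro sum_hausdorff_content_separated) (auto simp del: of_nat_Suc)
  then show "\<exists>N. \<forall>n\<ge>N. (\<Sum>i\<in>I. hausdorff_content s (\<delta> / real (Suc n)) (F i))
      \<le> hausdorff_content s (\<delta> / real (Suc n)) E" by blast
qed

text \<open>A real infimum is informative only over a nonempty set of exponents. Exponent 1 is such
  a witness: cover by \<open>{a}\<close> and otherwise empty sets, at total cost 0. This settles the
  degenerate case of diameter 0 below.\<close>

lemma hausdorff_dim_singleton_nonneg: "hausdorff_dim {a} \<ge> 0"
proof -
  have "hausdorff_content 1 \<delta> {a} = 0" if "\<delta> > 0" for \<delta>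
  proof -
    have "hausdorff_content 1 \<delta> {a}
        \<le> (\<Sum>i. ennreal (diam_powr 1 ((\<lambda>i::nat. if i = 0 then {a} else {}) i)))"
      unfolding hausdorff_content_def
      by (rule INF_lower) (use that in auto)
    also have "\<dots> = (\<Sum>i::nat. 0)"
      by (rule suminf_cong) (simp add: diam_powr_def)
    finally show ?thesis by simp
  qed
  then have "hausdorff_measure 1 {a} = 0"
    by (simp add: hausdorff_measure_def SUP_eq_const)
  then show ?thesis
    unfolding hausdorff_dim_def by (intro cInf_greatest) (auto intro: exI[of _ 1])
qed

text \<open>Since the cardinalities of \<open>\<epsilon>\<close>-separated subsets are bounded, one
  of them is largest. A point of \<open>E\<close> outside its \<open>\<epsilon>\<close>-balls could
  be added to it, so these balls cover \<open>E\<close>.\<close>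

lemma maximal_separated_net:
  fixes E :: "'a::metric_space set" and \<epsilon> :: real
  assumes "\<And>P. finite P \<Longrightarrow> P \<subseteq> E \<Longrightarrow> (\<And>x y. x \<in> P \<Longrightarrow> y \<in> P \<Longrightarrow> x \<noteq> y \<Longrightarrow> \<epsilon> \<le> dist x y)
      \<Longrightarrow> real (card P) \<le> c"
    and "\<epsilon> > 0"
  obtains P where "finite P" "E \<subseteq> (\<Union>p\<in>P. ball p \<epsilon>)" "real (card P) \<le> c"
proof -
  define Q where "Q P \<longleftrightarrow> finite P \<and> P \<subseteq> E \<and> (\<forall>x\<in>P. \<forall>y\<in>P. x \<noteq> y \<longrightarrow> \<epsilon> \<le> dist x y)" for P
  have c: "real (card P) \<le> c" if "Q P" for P
    using that assms(1)[of P] unfolding Q_def by blast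
  have "Q {}" by (simp add: Q_def)
  moreover have "\<forall>P. Q P \<longrightarrow> card P < Suc (nat \<lfloor>c\<rfloor>)"
    using c by (simp add: less_Suc_eq_le le_nat_floor)
  ultimately obtain P where P: "Q P" and max: "\<And>P'. Q P' \<Longrightarrow> card P' \<le> card P"
    using ex_has_greatest_nat[of Q "{}" card] by blast
  have "E \<subseteq> (\<Union>p\<in>P. ball p \<epsilon>)"
  proof (rule ccontr)
    assume "\<not> E \<subseteq> (\<Union>p\<in>P. ball p \<epsilon>)"
    then obtain y where y: "y \<in> E" "\<And>p. p \<in> P \<Longrightarrow> \<epsilon> \<le> dist p y" by force
    then have "Q (insert y P)" using P by (auto simp: Q_def dist_commute)
    moreover have "y \<notin> P" using y \<open>\<epsilon> > 0\<close> by force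
    ultimately show False using max[of "insert y P"] P by (simp add: Q_def)
  qed
  moreover have "finite P" using P by (simp add: Q_def)
  ultimately show thesis using c[OF P] by (intro that)
qed

text \<open>A packing argument: small balls around separated points carry mass at least of order
  \<open>\<epsilon> powr t\<close>, while a larger ball containing them has bounded mass. The cap
  \<open>\<epsilon>0\<close> is there because for nonempty \<open>A\<close> the count is at least 1,
  whereas \<open>inverse \<epsilon> powr t\<close> tends to 0 as \<open>\<epsilon>\<close> grows if
  \<open>t > 0\<close>.\<close>

lemma ahlfors_david_regular_cover:
  fixes A :: "'a::euclidean_space set"
  assumes "compact A" "ahlfors_david_regular A" "\<epsilon>0 > 0"
  obtains C where "C \<ge> 0" "\<And>\<epsilon>. 0 < \<epsilon> \<Longrightarrow> \<epsilon> \<le> \<epsilon>0 \<Longrightarrow>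
    \<exists>P. finite P \<and> A \<subseteq> (\<Union>p\<in>P. ball p \<epsilon>) \<and> real (card P) \<le> C * inverse \<epsilon> powr hausdorff_dim A"
proof (cases "A = {}")
  case True
  then show thesis by (intro that[of 0]) (auto intro: exI[of _ "{}"])
next
  case False
  then obtain a where a: "a \<in> A" by blast
  define t where "t = hausdorff_dim A"
  define D where "D = diameter A"
  have bA: "bounded A" using assms(1) compact_imp_bounded by blast
  have dD: "dist x y \<le> D" if "x \<in> A" "y \<in> A" for x y
    unfolding D_def using bA that by (rule diameter_bounded_bound)
  have "D \<ge> 0" using dD[OF a a] by simp
  obtain K where "K > 0" and K: "\<And>x \<delta>. x \<in> A \<Longrightarrow> \<delta> > 0 \<Longrightarrow> \<delta> < D \<Longrightarrow>
        ennreal (inverse K * \<delta> powr t) \<le> hausdorff_measure t (A \<inter> ball x \<delta>) \<and>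
        hausdorff_measure t (A \<inter> ball x \<delta>) \<le> ennreal (K * \<delta> powr t)"
    using assms(2) unfolding ahlfors_david_regular_def t_def D_def by blast
  have large: "\<exists>P. finite P \<and> A \<subseteq> (\<Union>p\<in>P. ball p \<epsilon>) \<and>
      real (card P) \<le> (\<epsilon>0 powr t + D powr t) * inverse \<epsilon> powr t"
    if "\<epsilon> > D" "\<epsilon> \<le> \<epsilon>0" for \<epsilon>
  proof (intro exI[of _ "{a}"] conjI)
    show "A \<subseteq> (\<Union>p\<in>{a}. ball p \<epsilon>)" using le_less_trans[OF dD[OF a] that(1)] by auto
    \<comment> \<open>The two summands serve the two possible signs of \<open>t\<close>: the first
      dominates for \<open>t \<ge> 0\<close>, the second for \<open>t < 0\<close>. In the latter
      case \<open>D\<close> is nonzero, since otherwise \<open>A\<close> would be a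
      singleton.\<close>
    have "\<epsilon> powr t \<le> \<epsilon>0 powr t + D powr t"
    proof (cases "t \<ge> 0")
      case True
      then have "\<epsilon> powr t \<le> \<epsilon>0 powr t" using that \<open>D \<ge> 0\<close> by (intro powr_mono2) auto
      then show ?thesis by (simp add: add_increasing2)
    next
      case False
      have "D \<noteq> 0"
      proof
        assume "D = 0"
        then have "x = a" if "x \<in> A" for x using dD[OF that a] by simp
        then have "A = {a}" using a by blast
        then show False using False hausdorff_dim_singleton_nonneg t_def by metis
      qed
      then have "\<epsilon> powr t \<le> D powr t" using that \<open>D \<ge> 0\<close> False by (intro powr_mono2') auto
      then show ?thesis by (simp add: add_increasing)
    qed
    moreover have "\<epsilon> > 0" using \<open>D \<ge> 0\<close> that by simp
    ultimately show "real (card {a}) \<le> (\<epsilon>0 powr t + D powr t) * inverse \<epsilon> powr t"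
      by (simp add: inverse_powr le_divide_eq flip: divide_inverse)
  qed simp
  show thesis
  proof (cases "D = 0")
    case True
    show thesis
      by (rule that[of "\<epsilon>0 powr t + D powr t"]) (use large True in \<open>simp_all add: t_def\<close>)
  next
    case False
    with \<open>D \<ge> 0\<close> have "D > 0" by simp
    \<comment> \<open>This is the quotient of the upper mass bound at radius \<open>D / 2\<close> by
      the lower mass bound at radius \<open>\<epsilon> / 4\<close>, with the factor
      \<open>inverse \<epsilon> powr t\<close> split off.\<close>
    define c where "c = K * K * (D / 2) powr t * 4 powr t"
    have "A \<subseteq> (\<Union>x\<in>A. ball x (D / 4))" using \<open>D > 0\<close> by auto
    then obtain X where X: "X \<subseteq> A" "finite X" "A \<subseteq> (\<Union>x\<in>X. ball x (D / 4))"
      using compactE_image[OF assms(1), of A "\<lambda>x. ball x (D / 4)"] by auto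
    \<comment> \<open>Regularity gives mass bounds only for radii strictly below \<open>D\<close>.
      Counting inside balls of radius \<open>D / 4\<close> keeps all radii that occur,
      \<open>\<epsilon> / 4\<close> and \<open>D / 2\<close>, in this range.\<close>
    have loc: "\<exists>P. finite P \<and> A \<inter> ball x (D / 4) \<subseteq> (\<Union>p\<in>P. ball p \<epsilon>) \<and>
        real (card P) \<le> c * inverse \<epsilon> powr t"
      if "0 < \<epsilon>" "\<epsilon> \<le> D" "x \<in> A" for x \<epsilon>
    proof -
      have bound: "real (card P) \<le> c * inverse \<epsilon> powr t"
        if P: "finite P" "P \<subseteq> A \<inter> ball x (D / 4)"
          "\<And>y z. y \<in> P \<Longrightarrow> z \<in> P \<Longrightarrow> y \<noteq> z \<Longrightarrow> \<epsilon> \<le> dist y z" for P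
      proof -
        have "ennreal (real (card P) * (inverse K * (\<epsilon> / 4) powr t))
            = (\<Sum>p\<in>P. ennreal (inverse K * (\<epsilon> / 4) powr t))"
          using \<open>K > 0\<close> by (simp add: ennreal_mult ennreal_of_nat_eq_real_of_nat)
        also have "\<dots> \<le> (\<Sum>p\<in>P. hausdorff_measure t (A \<inter> ball p (\<epsilon> / 4)))"
          using K[THEN conjunct1] P \<open>0 < \<epsilon>\<close> \<open>\<epsilon> \<le> D\<close> by (intro sum_mono) auto
        \<comment> \<open>The small balls lie in \<open>ball x (D / 2)\<close> because
          \<open>\<epsilon> / 4 \<le> D / 4\<close>. Their centres are \<open>\<epsilon>\<close>
          apart, so points of different balls are more than \<open>\<epsilon> / 2\<close>
          apart.\<close>
        also have "\<dots> \<le> hausdorff_measure t (A \<inter> ball x (D / 2))"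
        proof (rule sum_hausdorff_measure_separated[OF P(1)])
          show "\<epsilon> / 4 > 0" using \<open>0 < \<epsilon>\<close> by simp
          show "A \<inter> ball p (\<epsilon> / 4) \<subseteq> A \<inter> ball x (D / 2)" if "p \<in> P" for p
          proof -
            have "dist x p < D / 4" using P(2) that by auto
            then have "dist x y < D / 2" if "dist p y < \<epsilon> / 4" for y
              using dist_triangle[of x y p] that \<open>\<epsilon> \<le> D\<close> by simp
            then show ?thesis by auto
          qed
          fix p q y z
          assume pq: "p \<in> P" "q \<in> P" "p \<noteq> q" "y \<in> A \<inter> ball p (\<epsilon> / 4)" "z \<in> A \<inter> ball q (\<epsilon> / 4)"
          then have "\<epsilon> \<le> dist p q" "dist p y < \<epsilon> / 4" "dist q z < \<epsilon> / 4" using P(3) by auto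
          then show "\<epsilon> / 4 < dist y z"
            using dist_triangle[of p q y] dist_triangle[of y q z] \<open>0 < \<epsilon>\<close> by (simp add: dist_commute)
        qed
        also have "\<dots> \<le> ennreal (K * (D / 2) powr t)"
          using K[THEN conjunct2] \<open>x \<in> A\<close> \<open>D > 0\<close> by auto
        finally have "real (card P) * (inverse K * (\<epsilon> / 4) powr t) \<le> K * (D / 2) powr t"
          using \<open>K > 0\<close> by (simp add: ennreal_le_iff)
        \<comment> \<open>To be read with \<open>n\<close> the number of points,
          \<open>u = \<epsilon> powr t\<close>, \<open>v = 4 powr t\<close> and
          \<open>w = (D / 2) powr t\<close>.\<close>
        moreover have "n \<le> K * K * w * v * inverse u"
          if "n * (inverse K * (u / v)) \<le> K * w" "u > 0" "v > 0" for n u v w :: real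
          using that \<open>K > 0\<close> by (simp add: field_simps)
        ultimately show ?thesis
          using \<open>\<epsilon> > 0\<close> unfolding c_def powr_divide[of \<epsilon>] inverse_powr by simp
      qed
      show ?thesis
        by (rule maximal_separated_net[OF bound \<open>0 < \<epsilon>\<close>]) blast+
    qed
    have small: "\<exists>P. finite P \<and> A \<subseteq> (\<Union>p\<in>P. ball p \<epsilon>) \<and>
        real (card P) \<le> real (card X) * c * inverse \<epsilon> powr t" if "0 < \<epsilon>" "\<epsilon> \<le> D" for \<epsilon>
    proof -
      have "\<exists>P. \<forall>x\<in>X. finite (P x) \<and> A \<inter> ball x (D / 4) \<subseteq> (\<Union>p\<in>P x. ball p \<epsilon>) \<and>
          real (card (P x)) \<le> c * inverse \<epsilon> powr t"
        using loc[OF that] X(1) by (intro bchoice) blast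
      then obtain P where P: "\<And>x. x \<in> X \<Longrightarrow> finite (P x)"
          "\<And>x. x \<in> X \<Longrightarrow> A \<inter> ball x (D / 4) \<subseteq> (\<Union>p\<in>P x. ball p \<epsilon>)"
          "\<And>x. x \<in> X \<Longrightarrow> real (card (P x)) \<le> c * inverse \<epsilon> powr t"
        by blast
      show ?thesis
      proof (intro exI[of _ "\<Union>x\<in>X. P x"] conjI)
        show "finite (\<Union>x\<in>X. P x)" using P(1) X(2) by blast
        show "A \<subseteq> (\<Union>p\<in>(\<Union>x\<in>X. P x). ball p \<epsilon>)"
        proof
          fix y assume "y \<in> A"
          then obtain x where "x \<in> X" "y \<in> A \<inter> ball x (D / 4)" using X(3) by blast
          then show "y \<in> (\<Union>p\<in>(\<Union>x\<in>X. P x). ball p \<epsilon>)" using P(2) by blast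
        qed
        have "real (card (\<Union>x\<in>X. P x)) \<le> (\<Sum>x\<in>X. real (card (P x)))"
          using of_nat_mono[OF card_UN_le[OF X(2), of P]] by simp
        also have "\<dots> \<le> (\<Sum>x\<in>X. c * inverse \<epsilon> powr t)" using P(3) by (rule sum_mono)
        finally show "real (card (\<Union>x\<in>X. P x)) \<le> real (card X) * c * inverse \<epsilon> powr t"
          by simp
      qed
    qed
    have "c \<ge> 0" using \<open>K > 0\<close> by (simp add: c_def)
    define M where "M = max (\<epsilon>0 powr t + D powr t) (real (card X) * c)"
    have M: "(\<epsilon>0 powr t + D powr t) * inverse \<epsilon> powr t \<le> M * inverse \<epsilon> powr t"
      "real (card X) * c * inverse \<epsilon> powr t \<le> M * inverse \<epsilon> powr t" for \<epsilon>
      by (auto simp: M_def intro!: mult_right_mono)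
    show thesis
    proof (rule that[of M])
      show "M \<ge> 0" by (simp add: M_def le_max_iff_disj add_nonneg_nonneg)
      show "\<exists>P. finite P \<and> A \<subseteq> (\<Union>p\<in>P. ball p \<epsilon>) \<and> real (card P) \<le> M * inverse \<epsilon> powr hausdorff_dim A"
        if "0 < \<epsilon>" "\<epsilon> \<le> \<epsilon>0" for \<epsilon>
      proof (cases "\<epsilon> \<le> D")
        case True
        from small[OF that(1) this] obtain P where "finite P" "A \<subseteq> (\<Union>p\<in>P. ball p \<epsilon>)"
          "real (card P) \<le> real (card X) * c * inverse \<epsilon> powr t" by (elim exE conjE)
        with order_trans[OF this(3) M(2)] show ?thesis unfolding t_def by (intro exI conjI)
      next
        case False
        then have "D < \<epsilon>" by simp
        from large[OF this that(2)] obtain P where "finite P" "A \<subseteq> (\<Union>p\<in>P. ball p \<epsilon>)"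
          "real (card P) \<le> (\<epsilon>0 powr t + D powr t) * inverse \<epsilon> powr t" by (elim exE conjE)
        with order_trans[OF this(3) M(1)] show ?thesis unfolding t_def by (intro exI conjI)
      qed
    qed
  qed
qed

section \<open>Preimages of balls under local diffeomorphisms\<close>

text \<open>The mean value inequality on a convex ball. \<open>Ck_on\<close> only provides
  continuity of each directional derivative, so the operator norm is bounded by the sum over the
  basis directions, each bounded on a compact ball.\<close>

lemma Ck_on_1_locally_lipschitz:
  fixes g :: "'a::euclidean_space \<Rightarrow> 'b::real_normed_vector"
  assumes "Ck_on 1 g V" "open V" "y \<in> V"
  obtains r L where "r > 0" "L > 0" "ball y r \<subseteq> V"
    "\<And>u v. u \<in> ball y r \<Longrightarrow> v \<in> ball y r \<Longrightarrow> norm (g u - g v) \<le> L * norm (u - v)"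
proof -
  define g' where "g' x = frechet_derivative g (at x)" for x
  have der: "(g has_derivative g' x) (at x)" if "x \<in> V" for x
    using assms(1) that frechet_derivative_works unfolding g'_def One_nat_def Ck_on.simps by blast
  have cont: "continuous_on V (\<lambda>x. g' x v)" for v
    using assms(1) unfolding g'_def One_nat_def Ck_on.simps by blast
  obtain r where r: "r > 0" "cball y r \<subseteq> V"
    using assms(2,3) open_contains_cball by blast
  have "\<exists>M. \<forall>x\<in>cball y r. norm (g' x b) \<le> M" for b
  proof -
    have "compact ((\<lambda>x. g' x b) ` cball y r)"
      using cont r(2) by (intro compact_continuous_image) (auto intro: continuous_on_subset)
    then show ?thesis using compact_imp_bounded bounded_iff by (metis image_eqI)
  qed
  then obtain M where M: "\<And>b x. x \<in> cball y r \<Longrightarrow> norm (g' x b) \<le> M b" by metis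
  \<comment> \<open>The maximum with 1 ensures \<open>L > 0\<close> even if all derivatives
    vanish.\<close>
  define L where "L = max 1 (\<Sum>b\<in>Basis. M b)"
  show thesis
  proof (rule that[of r L])
    show "ball y r \<subseteq> V" using r(2) ball_subset_cball by blast
    fix u v assume uv: "u \<in> ball y r" "v \<in> ball y r"
    show "norm (g u - g v) \<le> L * norm (u - v)"
    proof (rule differentiable_bound[OF convex_ball _ _ uv])
      fix x assume x: "x \<in> ball y r"
      then have d: "(g has_derivative g' x) (at x)"
        using der \<open>ball y r \<subseteq> V\<close> by blast
      then show "(g has_derivative g' x) (at x within ball y r)"
        by (rule has_derivative_at_withinI)
      have "onorm (g' x) \<le> (\<Sum>b\<in>Basis. norm (g' x b))"
        using has_derivative_bounded_linear[OF d] by (rule onorm_componentwise)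
      also have "\<dots> \<le> (\<Sum>b\<in>Basis. M b)"
        using x by (intro sum_mono M) auto
      finally show "onorm (g' x) \<le> L" by (simp add: L_def)
    qed
  qed (use r(1) in \<open>auto simp: L_def\<close>)
qed

text \<open>The Lipschitz estimate for the local inverse \<open>g\<close> near \<open>s x\<close>,
  read at the points \<open>s u\<close> and \<open>s v\<close>, is the claimed lower bound on
  \<open>dist (s u) (s v)\<close>.\<close>

lemma local_smooth_diffeo_locally_expanding:
  fixes s :: "'a::euclidean_space \<Rightarrow> 'a"
  assumes "local_smooth_diffeo s"
  obtains U L where "open U" "x \<in> U" "L > 0"
    "\<And>u v. u \<in> U \<Longrightarrow> v \<in> U \<Longrightarrow> dist u v \<le> L * dist (s u) (s v)"
proof -
  obtain U V g where UV: "open U" "x \<in> U" "open V" "homeomorphism U V s g" "smooth_on g V"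
    using assms unfolding local_smooth_diffeo_def by blast
  have "s x \<in> V" using UV by (auto simp: homeomorphism_def)
  moreover have "Ck_on 1 g V" using UV(5) unfolding smooth_on_def by blast
  ultimately obtain r L where rL: "r > 0" "L > 0"
    "\<And>u v. u \<in> ball (s x) r \<Longrightarrow> v \<in> ball (s x) r \<Longrightarrow> norm (g u - g v) \<le> L * norm (u - v)"
    using Ck_on_1_locally_lipschitz[OF _ UV(3)] by metis
  have gs: "g (s u) = u" if "u \<in> U" for u
    using UV(4) that by (simp add: homeomorphism_def)
  show thesis
  proof (rule that[of "U \<inter> s -` ball (s x) r" L])
    show "open (U \<inter> s -` ball (s x) r)"
      using UV(1,4) by (intro continuous_open_preimage) (auto simp: homeomorphism_def)
    show "dist u v \<le> L * dist (s u) (s v)"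
      if "u \<in> U \<inter> s -` ball (s x) r" "v \<in> U \<inter> s -` ball (s x) r" for u v
      using rL(3)[of "s u" "s v"] that gs by (simp add: dist_norm)
  qed (use UV rL in auto)
qed

lemma local_smooth_diffeo_continuous:
  assumes "local_smooth_diffeo s"
  shows "continuous_on UNIV s"
proof -
  have "isCont s x" for x
  proof -
    obtain U V g where "open U" "x \<in> U" "homeomorphism U V s g"
      using assms unfolding local_smooth_diffeo_def by blast
    then show ?thesis
      using continuous_on_eq_continuous_at homeomorphism_def by blast
  qed
  then show ?thesis by (simp add: continuous_at_imp_continuous_on)
qed

text \<open>Finitely many neighbourhoods on which \<open>s\<close> is expanding cover
  \<open>K\<close>. Within each, two preimages of points of \<open>ball p r\<close> are less than
  \<open>2 * L x * r\<close> apart, so one ball of that radius around any of them contains the rest.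
  As the neighbourhoods are chosen before \<open>p\<close> and \<open>r\<close>, the constant is
  uniform, although \<open>s\<close> may fail to be injective.\<close>

lemma emeasure_local_smooth_diffeo_vimage_ball:
  fixes s :: "'a::euclidean_space \<Rightarrow> 'a"
  assumes "local_smooth_diffeo s" "compact K"
  obtains C where "C \<ge> 0"
    "\<And>p r. r > 0 \<Longrightarrow> emeasure lborel (K \<inter> s -` ball p r) \<le> ennreal (C * r ^ DIM('a))"
proof -
  have "\<forall>x. \<exists>U L. open U \<and> x \<in> U \<and> L > 0 \<and> (\<forall>u\<in>U. \<forall>v\<in>U. dist u v \<le> L * dist (s u) (s v))"
    using local_smooth_diffeo_locally_expanding[OF assms(1)] by metis
  then obtain U L where UL: "\<And>x. open (U x)" "\<And>x. x \<in> U x" "\<And>x. L x > 0"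
    "\<And>x u v. u \<in> U x \<Longrightarrow> v \<in> U x \<Longrightarrow> dist u v \<le> L x * dist (s u) (s v)" by metis
  have "K \<subseteq> (\<Union>x\<in>K. U x)" using UL(2) by blast
  then obtain X where X: "finite X" "K \<subseteq> (\<Union>x\<in>X. U x)"
    using compactE_image[OF assms(2), of K U] UL(1) by metis
  define C where "C = (\<Sum>x\<in>X. unit_ball_vol (real DIM('a)) * (2 * L x) ^ DIM('a))"
  show thesis
  proof (rule that[of C])
    show "C \<ge> 0" using UL(3) by (auto simp: C_def less_imp_le intro!: sum_nonneg mult_nonneg_nonneg)
    fix p :: 'a and r :: real assume "r > 0"
    \<comment> \<open>\<open>w x\<close> is arbitrary when \<open>U x\<close> misses the preimage of the ball.\<close>
    define w where "w x = (SOME u. u \<in> U x \<and> s u \<in> ball p r)" for x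
    have "K \<inter> s -` ball p r \<subseteq> (\<Union>x\<in>X. ball (w x) (2 * L x * r))"
    proof
      fix u assume u: "u \<in> K \<inter> s -` ball p r"
      then obtain x where x: "x \<in> X" "u \<in> U x" using X(2) by blast
      then have "\<exists>u. u \<in> U x \<and> s u \<in> ball p r" using u by blast
      then have w: "w x \<in> U x \<and> s (w x) \<in> ball p r"
        unfolding w_def by (rule someI_ex)
      have "dist (s (w x)) (s u) < 2 * r"
        using w u dist_triangle[of "s (w x)" "s u" p] by (simp add: dist_commute)
      then have "L x * dist (s (w x)) (s u) < L x * (2 * r)"
        using UL(3) by simp
      then have "dist (w x) u < 2 * L x * r"
        using UL(4)[of "w x" x u] w x by (simp add: mult_ac)
      then show "u \<in> (\<Union>x\<in>X. ball (w x) (2 * L x * r))" using x by auto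
    qed
    then have "emeasure lborel (K \<inter> s -` ball p r)
        \<le> emeasure lborel (\<Union>x\<in>X. ball (w x) (2 * L x * r))"
      by (rule emeasure_mono) (use X(1) in \<open>auto intro!: sets.finite_UN\<close>)
    also have "\<dots> \<le> (\<Sum>x\<in>X. emeasure lborel (ball (w x) (2 * L x * r)))"
      using X(1) by (intro emeasure_subadditive_finite) auto
    also have "\<dots> = (\<Sum>x\<in>X. ennreal (unit_ball_vol (real DIM('a)) * (2 * L x * r) ^ DIM('a)))"
      using UL(3) \<open>r > 0\<close> by (intro sum.cong refl emeasure_ball) (simp add: less_imp_le)
    also have "\<dots> = ennreal (\<Sum>x\<in>X. unit_ball_vol (real DIM('a)) * (2 * L x * r) ^ DIM('a))"
      using UL(3) \<open>r > 0\<close> by (intro sum_ennreal) (simp add: less_imp_le)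
    also have "(\<Sum>x\<in>X. unit_ball_vol (real DIM('a)) * (2 * L x * r) ^ DIM('a)) = C * r ^ DIM('a)"
      unfolding C_def sum_distrib_right by (intro sum.cong refl) (simp add: power_mult_distrib)
    finally show "emeasure lborel (K \<inter> s -` ball p r) \<le> ennreal (C * r ^ DIM('a))" .
  qed
qed

section \<open>Covering numbers of the intersections\<close>

lemma covering_number_le:
  assumes "finite P" "E \<subseteq> (\<Union>p\<in>P. ball p \<epsilon>)"
  shows "covering_number E \<epsilon> \<le> card P"
  unfolding covering_number_def using assms by (intro Least_le) blast

lemma covering_number_attained:
  assumes "finite P" "E \<subseteq> (\<Union>p\<in>P. ball p \<epsilon>)"
  obtains P' where "finite P'" "card P' = covering_number E \<epsilon>" "E \<subseteq> (\<Union>p\<in>P'. ball p \<epsilon>)"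
proof -
  have "\<exists>P'. finite P' \<and> card P' = covering_number E \<epsilon> \<and> E \<subseteq> (\<Union>p\<in>P'. ball p \<epsilon>)"
    unfolding covering_number_def by (rule LeastI[of _ "card P"]) (use assms in blast)
  with that show thesis by blast
qed

lemma compact_finite_ball_cover:
  fixes A :: "'a::metric_space set"
  assumes "compact A" "\<epsilon> > 0"
  obtains P where "finite P" "A \<subseteq> (\<Union>p\<in>P. ball p \<epsilon>)"
proof -
  have "A \<subseteq> (\<Union>p\<in>A. ball p \<epsilon>)" using assms(2) by auto
  then show thesis
    using compactE_image[OF assms(1), of A "\<lambda>p. ball p \<epsilon>"] that by (metis open_ball)
qed

text \<open>Upper semicontinuity of the compact-valued map \<open>x \<mapsto> A \<inter> (s(x) - B)\<close>.\<close>

lemma open_Int_translate_reflect_subset: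
  fixes A B :: "'a::real_normed_vector set" and s :: "'b::topological_space \<Rightarrow> 'a"
  assumes "compact A" "compact B" "continuous_on UNIV s" "open U"
  shows "open {x. A \<inter> {s x - b | b. b \<in> B} \<subseteq> U}"
proof -
  \<comment> \<open>The inclusion in \<open>U\<close> fails exactly when \<open>s x = a + b\<close>
    for some \<open>a \<in> A - U\<close> and \<open>b \<in> B\<close>; such sums form a compact
    set.\<close>
  have "compact {a + b | a b. a \<in> A - U \<and> b \<in> B}"
    using assms by (intro compact_sums compact_diff)
  then have "closed (s -` {a + b | a b. a \<in> A - U \<and> b \<in> B})"
    using assms(3) by (intro closed_vimage compact_imp_closed)
  moreover have "{x. A \<inter> {s x - b | b. b \<in> B} \<subseteq> U} = - (s -` {a + b | a b. a \<in> A - U \<and> b \<in> B})"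
  proof (intro equalityI subsetI)
    fix x assume x: "x \<in> {x. A \<inter> {s x - b | b. b \<in> B} \<subseteq> U}"
    show "x \<in> - (s -` {a + b | a b. a \<in> A - U \<and> b \<in> B})"
    proof
      assume "x \<in> s -` {a + b | a b. a \<in> A - U \<and> b \<in> B}"
      then obtain a b where ab: "s x = a + b" "a \<in> A" "a \<notin> U" "b \<in> B" by blast
      then have "a = s x - b" by simp
      with ab x show False by blast
    qed
  next
    fix x assume x: "x \<in> - (s -` {a + b | a b. a \<in> A - U \<and> b \<in> B})"
    have "s x - b \<in> U" if "b \<in> B" "s x - b \<in> A" for b
    proof (rule ccontr)
      assume "s x - b \<notin> U"
      moreover have "s x = (s x - b) + b" by simp
      ultimately show False using x that by blast
    qed
    then show "x \<in> {x. A \<inter> {s x - b | b. b \<in> B} \<subseteq> U}" by blast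
  qed
  ultimately show ?thesis by (simp add: open_Compl)
qed

text \<open>Having a cover by at most \<open>n\<close> balls with fixed centres is an open condition
  on \<open>x\<close>, by the upper semicontinuity above. The sublevel sets are unions of these open
  sets over all choices of centres, hence open although the union is uncountable.\<close>

lemma borel_measurable_covering_number:
  fixes A B :: "'a::real_normed_vector set" and s :: "'b::topological_space \<Rightarrow> 'a"
  assumes "compact A" "compact B" "continuous_on UNIV s" "\<epsilon> > 0"
  shows "(\<lambda>x. real (covering_number (A \<inter> {s x - b | b. b \<in> B}) \<epsilon>)) \<in> borel_measurable borel"
proof -
  define F where "F x = A \<inter> {s x - b | b. b \<in> B}" for x
  have usc: "open {x. F x \<subseteq> U}" if "open U" for U
    unfolding F_def using assms(1-3) that by (rule open_Int_translate_reflect_subset)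
  \<comment> \<open>One finite cover of \<open>A\<close> serves every \<open>x\<close>; it
    guarantees that the \<open>LEAST\<close> in \<open>covering_number\<close> is attained.\<close>
  obtain P0 where P0: "finite P0" "A \<subseteq> (\<Union>p\<in>P0. ball p \<epsilon>)"
    by (rule compact_finite_ball_cover[OF assms(1,4)])
  have sub: "F x \<subseteq> (\<Union>p\<in>P0. ball p \<epsilon>)" for x
    using P0(2) by (auto simp: F_def)
  have op: "open {x. covering_number (F x) \<epsilon> \<le> n}" for n
  proof -
    have "covering_number (F x) \<epsilon> \<le> n \<longleftrightarrow>
        (\<exists>P\<in>{P. finite P \<and> card P \<le> n}. F x \<subseteq> (\<Union>p\<in>P. ball p \<epsilon>))" for x
    proof
      assume n: "covering_number (F x) \<epsilon> \<le> n"
      obtain P where "finite P" "card P = covering_number (F x) \<epsilon>" "F x \<subseteq> (\<Union>p\<in>P. ball p \<epsilon>)"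
        by (rule covering_number_attained[OF P0(1) sub])
      with n show "\<exists>P\<in>{P. finite P \<and> card P \<le> n}. F x \<subseteq> (\<Union>p\<in>P. ball p \<epsilon>)"
        by (intro bexI[of _ P]) simp_all
    qed (use covering_number_le order_trans in blast)
    then have "{x. covering_number (F x) \<epsilon> \<le> n}
        = (\<Union>P\<in>{P. finite P \<and> card P \<le> n}. {x. F x \<subseteq> (\<Union>p\<in>P. ball p \<epsilon>)})"
      by blast
    then show ?thesis by (auto intro!: open_UN usc)
  qed
  have "{x. real (covering_number (F x) \<epsilon>) \<le> a} \<in> sets borel" for a
  proof (cases "a \<ge> 0")
    case True
    then have "real m \<le> a \<longleftrightarrow> m \<le> nat \<lfloor>a\<rfloor>" for m
      by (simp add: le_nat_iff le_floor_iff)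
    then show ?thesis using op by simp
  next
    case False
    then have "\<not> real m \<le> a" for m by linarith
    then show ?thesis by simp
  qed
  then show ?thesis unfolding F_def by (simp add: borel_measurable_iff_le)
qed

text \<open>If \<open>a = z - b\<close> with \<open>a\<close> near \<open>p\<close> and
  \<open>b\<close> near \<open>q\<close>, then \<open>z = a + b\<close> is within
  \<open>2 * \<epsilon>\<close> of \<open>p + q\<close>. Centres \<open>p\<close> without such a
  \<open>q\<close> can be discarded, and each remaining one contributes at least 1 to the double
  sum.\<close>

lemma covering_number_le_sum_indicator:
  fixes A B P Q :: "'a::real_normed_vector set"
  assumes "finite P" "A \<subseteq> (\<Union>p\<in>P. ball p \<epsilon>)" "finite Q" "B \<subseteq> (\<Union>q\<in>Q. ball q \<epsilon>)"
  shows "ennreal (real (covering_number (A \<inter> {z - b | b. b \<in> B}) \<epsilon>))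
    \<le> (\<Sum>p\<in>P. \<Sum>q\<in>Q. indicator (ball (p + q) (2 * \<epsilon>)) z)"
proof -
  define R where "R = {p \<in> P. \<exists>q\<in>Q. z \<in> ball (p + q) (2 * \<epsilon>)}"
  have "R \<subseteq> P" by (auto simp: R_def)
  have "A \<inter> {z - b | b. b \<in> B} \<subseteq> (\<Union>p\<in>R. ball p \<epsilon>)"
  proof
    fix a assume "a \<in> A \<inter> {z - b | b. b \<in> B}"
    then obtain b where ab: "a \<in> A" "b \<in> B" "a = z - b" by blast
    then obtain p q where pq: "p \<in> P" "q \<in> Q" "dist p a < \<epsilon>" "dist q b < \<epsilon>"
      using assms(2,4) by fastforce
    then have "dist (p + q) (a + b) < 2 * \<epsilon>"
      using dist_triangle_add[of p q a b] by simp
    then have "p \<in> R" using pq ab(3) by (auto simp: R_def)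
    then show "a \<in> (\<Union>p\<in>R. ball p \<epsilon>)" using pq(3) by auto
  qed
  then have "covering_number (A \<inter> {z - b | b. b \<in> B}) \<epsilon> \<le> card R"
    using \<open>R \<subseteq> P\<close> assms(1) by (intro covering_number_le) (auto intro: finite_subset)
  then have "ennreal (real (covering_number (A \<inter> {z - b | b. b \<in> B}) \<epsilon>)) \<le> (\<Sum>p\<in>R. 1)"
    by (simp flip: ennreal_of_nat_eq_real_of_nat)
  also have "\<dots> \<le> (\<Sum>p\<in>R. \<Sum>q\<in>Q. indicator (ball (p + q) (2 * \<epsilon>)) z)"
  proof (rule sum_mono)
    fix p assume "p \<in> R"
    then obtain q where q: "q \<in> Q" "z \<in> ball (p + q) (2 * \<epsilon>)" by (auto simp: R_def)
    have "(1::ennreal) = indicator (ball (p + q) (2 * \<epsilon>)) z" using q(2) by simp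
    also have "\<dots> \<le> (\<Sum>q\<in>Q. indicator (ball (p + q) (2 * \<epsilon>)) z)"
      by (rule member_le_sum[OF q(1) _ assms(3)]) simp
    finally show "(1::ennreal) \<le> (\<Sum>q\<in>Q. indicator (ball (p + q) (2 * \<epsilon>)) z)" .
  qed
  also have "\<dots> \<le> (\<Sum>p\<in>P. \<Sum>q\<in>Q. indicator (ball (p + q) (2 * \<epsilon>)) z)"
    using assms(1) \<open>R \<subseteq> P\<close> by (intro sum_mono2) auto
  finally show ?thesis .
qed

text \<open>Integrating the double sum over \<open>K\<close> costs at most
  \<open>D * (2 * \<epsilon>) ^ DIM('a)\<close> for each pair of centres; multiplied by the two
  cardinality bounds, the powers of \<open>\<epsilon>\<close> combine to the stated
  exponent.\<close>

lemma nn_integral_covering_number_le: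
  fixes A B :: "'a::euclidean_space set" and s :: "'a \<Rightarrow> 'a"
  assumes "compact A" "compact B" "ahlfors_david_regular A" "ahlfors_david_regular B"
    and "local_smooth_diffeo s" "compact K" "\<epsilon>0 > 0"
  shows "\<exists>C\<ge>0. \<forall>\<epsilon>\<in>{0<..\<epsilon>0}.
    (\<integral>\<^sup>+x. ennreal (real (covering_number (A \<inter> {s x - b | b. b \<in> B}) \<epsilon>)) * indicator K x \<partial>lborel)
      \<le> ennreal (C * inverse \<epsilon> powr (hausdorff_dim A + hausdorff_dim B - real DIM('a)))"
proof -
  obtain CA where CA: "CA \<ge> 0" "\<And>\<epsilon>. 0 < \<epsilon> \<Longrightarrow> \<epsilon> \<le> \<epsilon>0 \<Longrightarrow>
    \<exists>P. finite P \<and> A \<subseteq> (\<Union>p\<in>P. ball p \<epsilon>) \<and> real (card P) \<le> CA * inverse \<epsilon> powr hausdorff_dim A"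
    by (rule ahlfors_david_regular_cover[OF assms(1,3,7)]) (rule that, assumption, blast)
  obtain CB where CB: "CB \<ge> 0" "\<And>\<epsilon>. 0 < \<epsilon> \<Longrightarrow> \<epsilon> \<le> \<epsilon>0 \<Longrightarrow>
    \<exists>P. finite P \<and> B \<subseteq> (\<Union>p\<in>P. ball p \<epsilon>) \<and> real (card P) \<le> CB * inverse \<epsilon> powr hausdorff_dim B"
    by (rule ahlfors_david_regular_cover[OF assms(2,4,7)]) (rule that, assumption, blast)
  obtain D where D: "D \<ge> 0"
    "\<And>p r. r > 0 \<Longrightarrow> emeasure lborel (K \<inter> s -` ball p r) \<le> ennreal (D * r ^ DIM('a))"
    by (rule emeasure_local_smooth_diffeo_vimage_ball[OF assms(5,6)]) (rule that, assumption, blast)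
  have cont: "continuous_on UNIV s" using local_smooth_diffeo_continuous[OF assms(5)] .
  define C where "C = CA * CB * D * 2 ^ DIM('a)"
  show ?thesis
  proof (intro exI[of _ C] conjI ballI)
    show "C \<ge> 0" using CA D CB by (simp add: C_def)
    fix \<epsilon> :: real assume "\<epsilon> \<in> {0<..\<epsilon>0}"
    then have \<epsilon>: "0 < \<epsilon>" "\<epsilon> \<le> \<epsilon>0" by simp_all
    obtain P where P: "finite P" "A \<subseteq> (\<Union>p\<in>P. ball p \<epsilon>)"
      "real (card P) \<le> CA * inverse \<epsilon> powr hausdorff_dim A"
      using CA(2)[OF \<epsilon>] by (elim exE conjE)
    obtain Q where Q: "finite Q" "B \<subseteq> (\<Union>q\<in>Q. ball q \<epsilon>)"
      "real (card Q) \<le> CB * inverse \<epsilon> powr hausdorff_dim B"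
      using CB(2)[OF \<epsilon>] by (elim exE conjE)
    let ?N = "\<lambda>x. ennreal (real (covering_number (A \<inter> {s x - b | b. b \<in> B}) \<epsilon>))"
    have meas: "K \<inter> s -` ball p r \<in> sets lborel" for p r
      unfolding sets_lborel
      by (rule sets.Int[OF borel_compact[OF assms(6)] borel_open[OF open_vimage[OF open_ball cont]]])
    have "(\<integral>\<^sup>+x. ?N x * indicator K x \<partial>lborel)
        \<le> (\<integral>\<^sup>+x. (\<Sum>p\<in>P. \<Sum>q\<in>Q. indicator (K \<inter> s -` ball (p + q) (2 * \<epsilon>)) x) \<partial>lborel)"
    proof (rule nn_integral_mono)
      fix x
      have "?N x \<le> (\<Sum>p\<in>P. \<Sum>q\<in>Q. indicator (ball (p + q) (2 * \<epsilon>)) (s x))"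
        by (rule covering_number_le_sum_indicator[OF P(1,2) Q(1,2)])
      then show "?N x * indicator K x
          \<le> (\<Sum>p\<in>P. \<Sum>q\<in>Q. indicator (K \<inter> s -` ball (p + q) (2 * \<epsilon>)) x)"
        by (cases "x \<in> K") (simp_all add: indicator_def)
    qed
    also have "\<dots> = (\<Sum>p\<in>P. \<Sum>q\<in>Q. emeasure lborel (K \<inter> s -` ball (p + q) (2 * \<epsilon>)))"
      using meas by (simp add: nn_integral_sum)
    also have "\<dots> \<le> (\<Sum>p\<in>P. \<Sum>q\<in>Q. ennreal (D * (2 * \<epsilon>) ^ DIM('a)))"
      using \<epsilon> by (intro sum_mono D) auto
    also have "\<dots> = ennreal (real (card P) * real (card Q) * (D * (2 * \<epsilon>) ^ DIM('a)))"
      using D \<epsilon> by (simp add: ennreal_mult ennreal_of_nat_eq_real_of_nat mult_ac)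
    also have "\<dots> \<le> ennreal (C * inverse \<epsilon> powr (hausdorff_dim A + hausdorff_dim B - real DIM('a)))"
    proof (rule ennreal_leI)
      have "real (card P) * real (card Q) * (D * (2 * \<epsilon>) ^ DIM('a))
          \<le> (CA * inverse \<epsilon> powr hausdorff_dim A) * (CB * inverse \<epsilon> powr hausdorff_dim B)
             * (D * (2 * \<epsilon>) ^ DIM('a))"
        using P(3) Q(3) D \<epsilon> CA CB by (intro mult_right_mono mult_mono) auto
      also have "\<dots> = C * inverse \<epsilon> powr (hausdorff_dim A + hausdorff_dim B - real DIM('a))"
        using \<epsilon> by (simp add: C_def powr_add powr_diff powr_realpow power_mult_distrib
            power_inverse field_simps)
      finally show "real (card P) * real (card Q) * (D * (2 * \<epsilon>) ^ DIM('a))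
          \<le> C * inverse \<epsilon> powr (hausdorff_dim A + hausdorff_dim B - real DIM('a))" .
    qed
    finally show "(\<integral>\<^sup>+x. ?N x * indicator K x \<partial>lborel)
      \<le> ennreal (C * inverse \<epsilon> powr (hausdorff_dim A + hausdorff_dim B - real DIM('a)))" .
  qed
qed

section \<open>The integral bound and the almost everywhere bound\<close>

text \<open>If the lower limit exceeded some \<open>y > t\<close>, the covering number at scale
  \<open>(1/2) ^ k\<close> would eventually exceed \<open>2 powr (k * y)\<close>, so its product
  with \<open>((1/2) ^ k) powr t\<close> would tend to infinity, against the bound by
  \<open>M\<close> for infinitely many \<open>k\<close>.\<close>

lemma lower_minkowski_dim_le_dyadic:
  assumes "t \<ge> 0"
    and freq: "\<exists>\<^sub>F k in sequentially. real (covering_number E ((1/2) ^ k)) * ((1/2) ^ k) powr t \<le> M"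
  shows "lower_minkowski_dim E \<le> ereal t"
proof (cases "E = {}")
  case True
  then show ?thesis using assms(1) by (simp add: lower_minkowski_dim_def)
next
  case False
  let ?q = "\<lambda>\<epsilon>. ln (real (covering_number E \<epsilon>)) / ln (1 / \<epsilon>)"
  show ?thesis
  proof (rule ccontr)
    assume "\<not> lower_minkowski_dim E \<le> ereal t"
    then have "ereal t < Liminf (at_right 0) (\<lambda>\<epsilon>. ereal (?q \<epsilon>))"
      using False by (simp add: lower_minkowski_dim_def)
    from ereal_dense2[OF this]
    obtain y where y: "t < y" "ereal y < Liminf (at_right 0) (\<lambda>\<epsilon>. ereal (?q \<epsilon>))"
      by auto
    have "\<forall>\<^sub>F \<epsilon> in at_right 0. y < ?q \<epsilon>"
      using less_LiminfD[OF y(2)] by simp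
    moreover have "filterlim (\<lambda>k. (1/2::real) ^ k) (at_right 0) sequentially"
      unfolding filterlim_at by (auto intro: LIMSEQ_realpow_zero)
    ultimately have ev1: "\<forall>\<^sub>F k in sequentially. y < ?q ((1/2) ^ k)"
      by (rule eventually_compose_filterlim)
    have "filterlim (\<lambda>k. real k * ((y - t) * ln 2)) at_top sequentially"
      using y(1) by (intro filterlim_at_top_mult_tendsto_pos[OF tendsto_const] filterlim_real_sequentially) simp
    then have ev2: "\<forall>\<^sub>F k in sequentially. ln M < real k * ((y - t) * ln 2)"
      by (simp add: filterlim_at_top_dense)
    \<comment> \<open>At \<open>k = 0\<close> the denominator \<open>ln (1 / \<epsilon>)\<close> is
      0, and the quotient could not be cleared.\<close>
    have ev3: "\<forall>\<^sub>F k::nat in sequentially. 0 < k"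
      by (rule eventually_gt_at_top)
    have "\<exists>\<^sub>F k in sequentially. False"
    proof (rule frequently_mp[OF _ freq], use ev1 ev2 ev3 in eventually_elim, intro impI)
      fix k :: nat
      let ?N = "real (covering_number E ((1/2) ^ k))"
      assume k: "y < ?q ((1/2) ^ k)" "ln M < real k * ((y - t) * ln 2)" "0 < k"
        and M: "?N * ((1/2) ^ k) powr t \<le> M"
      have "ln (1 / (1/2::real) ^ k) = real k * ln 2"
        by (simp add: power_one_over ln_realpow)
      then have q: "y * (real k * ln 2) < ln ?N"
        using k(1,3) by (simp add: pos_less_divide_eq)
      \<comment> \<open>With the convention \<open>ln 0 = 0\<close>, a zero covering number would
        make the quotient 0, which is not above \<open>y > t \<ge> 0\<close>.\<close>
      have "?N > 0"
      proof (rule ccontr)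
        assume "\<not> ?N > 0"
        then have "?N = 0" by simp
        then have "y * (real k * ln 2) < 0" using q by simp
        moreover have "0 \<le> y * (real k * ln 2)" using y(1) assms(1) by simp
        ultimately show False by simp
      qed
      then have "?N * ((1/2) ^ k) powr t > 0" by simp
      then have "ln (?N * ((1/2) ^ k) powr t) \<le> ln M" using M by simp
      moreover have "ln (?N * ((1/2) ^ k) powr t) = ln ?N - t * (real k * ln 2)"
        using \<open>?N > 0\<close> by (simp add: ln_mult ln_powr ln_realpow ln_div)
      ultimately have "y * (real k * ln 2) < real k * ((y - t) * ln 2) + t * (real k * ln 2)"
        using q k(2) by linarith
      then show False by (simp add: algebra_simps)
    qed
    then show False by simp
  qed
qed

text \<open>The integral bound holds over compact sets, so Fatou's lemma is applied on each ball of
  integer radius, and the countably many exceptional null sets are united.\<close>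

lemma AE_lower_minkowski_dim_le:
  fixes A B :: "'a::euclidean_space set" and s :: "'a \<Rightarrow> 'a"
  assumes "compact A" "compact B" "ahlfors_david_regular A" "ahlfors_david_regular B"
    and "local_smooth_diffeo s" and nonneg: "hausdorff_dim A + hausdorff_dim B - real DIM('a) \<ge> 0"
  shows "AE x in lborel. lower_minkowski_dim (A \<inter> {s x - b | b. b \<in> B})
    \<le> ereal (hausdorff_dim A + hausdorff_dim B - real DIM('a))"
proof -
  define t where "t = hausdorff_dim A + hausdorff_dim B - real DIM('a)"
  define N where "N = (\<lambda>\<epsilon> x. real (covering_number (A \<inter> {s x - b | b. b \<in> B}) \<epsilon>))"
  define \<epsilon> where "\<epsilon> k = (1/2::real) ^ k" for k :: nat
  have \<epsilon>: "0 < \<epsilon> k" "\<epsilon> k \<le> 1" for k by (auto simp: \<epsilon>_def power_le_one)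
  have meas: "N (\<epsilon> k) \<in> borel_measurable lborel" for k
    using borel_measurable_covering_number[OF assms(1,2) local_smooth_diffeo_continuous[OF assms(5)] \<epsilon>(1)]
    unfolding N_def measurable_lborel2 .
  have "AE x in lborel. x \<in> cball 0 (real R) \<longrightarrow>
      lower_minkowski_dim (A \<inter> {s x - b | b. b \<in> B}) \<le> ereal t" for R :: nat
  proof -
    obtain C where C: "C \<ge> 0" "\<forall>\<epsilon>\<in>{0<..1}.
        (\<integral>\<^sup>+x. ennreal (N \<epsilon> x) * indicator (cball 0 (real R)) x \<partial>lborel) \<le> ennreal (C * inverse \<epsilon> powr t)"
      using nn_integral_covering_number_le[OF assms(1-5) compact_cball[of 0 "real R"] zero_less_one]
      unfolding N_def t_def by (elim exE conjE)
    \<comment> \<open>The factor \<open>\<epsilon> k powr t\<close> cancels the power in the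
      integral bound, so all the integrals are at most \<open>C\<close>.\<close>
    define u where
      "u = (\<lambda>k x. ennreal (\<epsilon> k powr t) * (ennreal (N (\<epsilon> k) x) * indicator (cball 0 (real R)) x))"
    have N_meas: "(\<lambda>x. ennreal (N (\<epsilon> k) x) * indicator (cball 0 (real R)) x) \<in> borel_measurable lborel" for k
      by (intro borel_measurable_times_ennreal measurable_compose[OF meas measurable_ennreal]
          borel_measurable_indicator) simp
    have u_meas: "u k \<in> borel_measurable lborel" for k
      unfolding u_def by (intro borel_measurable_times_ennreal borel_measurable_const N_meas)
    have "(\<integral>\<^sup>+x. u k x \<partial>lborel) \<le> ennreal C" for k
    proof -
      have "(\<integral>\<^sup>+x. u k x \<partial>lborel) = ennreal (\<epsilon> k powr t) *
          (\<integral>\<^sup>+x. ennreal (N (\<epsilon> k) x) * indicator (cball 0 (real R)) x \<partial>lborel)"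
        unfolding u_def by (rule nn_integral_cmult[OF N_meas])
      also have "\<dots> \<le> ennreal (\<epsilon> k powr t) * ennreal (C * inverse (\<epsilon> k) powr t)"
        using C(2) \<epsilon> by (intro mult_left_mono) auto
      also have "\<dots> = ennreal C"
      proof -
        have "\<epsilon> k powr t * (C * inverse (\<epsilon> k) powr t) = C"
          unfolding inverse_powr using \<epsilon>(1)[of k] by (simp add: field_simps)
        then show ?thesis by (simp only: powr_ge_zero flip: ennreal_mult')
      qed
      finally show ?thesis .
    qed
    then have "liminf (\<lambda>k. \<integral>\<^sup>+x. u k x \<partial>lborel) \<le> liminf (\<lambda>k. ennreal C)"
      by (intro Liminf_mono always_eventually allI)
    then have "(\<integral>\<^sup>+x. liminf (\<lambda>k. u k x) \<partial>lborel) \<le> ennreal C"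
      using nn_integral_liminf[of u lborel, OF u_meas] by (simp add: Liminf_const)
    then have "(\<integral>\<^sup>+x. liminf (\<lambda>k. u k x) \<partial>lborel) \<noteq> \<infinity>"
      by (auto simp: top_unique)
    then have "AE x in lborel. liminf (\<lambda>k. u k x) \<noteq> \<infinity>"
      using u_meas by (intro nn_integral_noteq_infinite borel_measurable_liminf)
    then show ?thesis
    proof (eventually_elim, intro impI)
      fix x :: 'a assume fin: "liminf (\<lambda>k. u k x) \<noteq> \<infinity>" and x: "x \<in> cball 0 (real R)"
      then obtain M where M: "liminf (\<lambda>k. u k x) < ennreal (real M)"
        using ennreal_Ex_less_of_nat[of "liminf (\<lambda>k. u k x)"]
        by (auto simp: less_top ennreal_of_nat_eq_real_of_nat)
      \<comment> \<open>Were \<open>u k x\<close> eventually at least \<open>M\<close>, so would be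
        its lower limit; hence it drops below \<open>M\<close> for infinitely many
        \<open>k\<close>.\<close>
      have "\<not> (\<forall>\<^sub>F k in sequentially. ennreal (real M) \<le> u k x)"
        using Liminf_bounded[of "ennreal (real M)" "\<lambda>k. u k x" sequentially] M by auto
      then have "\<exists>\<^sub>F k in sequentially. u k x < ennreal (real M)"
        by (simp add: frequently_def not_less)
      then have "\<exists>\<^sub>F k in sequentially. N (\<epsilon> k) x * \<epsilon> k powr t \<le> real M"
      proof (rule frequently_elim1)
        fix k assume "u k x < ennreal (real M)"
        then show "N (\<epsilon> k) x * \<epsilon> k powr t \<le> real M"
          using x by (simp add: u_def N_def ennreal_less_iff mult.commute flip: ennreal_mult)
      qed
      then show "lower_minkowski_dim (A \<inter> {s x - b | b. b \<in> B}) \<le> ereal t"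
        using nonneg unfolding N_def \<epsilon>_def t_def by (intro lower_minkowski_dim_le_dyadic)
    qed
  qed
  then have "AE x in lborel. \<forall>R::nat. x \<in> cball 0 (real R) \<longrightarrow>
      lower_minkowski_dim (A \<inter> {s x - b | b. b \<in> B}) \<le> ereal t"
    unfolding AE_all_countable ..
  then show ?thesis
    unfolding t_def
  proof eventually_elim
    case (elim x)
    obtain R :: nat where "norm x \<le> real R" using real_arch_simple by blast
    then show ?case using elim[rule_format, of R] by simp
  qed
qed

text \<open>The sign of \<open>\<psi>\<close> is arbitrary, so \<open>\<bar>\<psi>\<bar>\<close> is
  dominated by a multiple of the indicator of its compact support. Integrability is asserted as
  well, since the Bochner integral of a non-integrable function is 0 by convention and a bound on it
  would say nothing.\<close>

lemma integral_covering_number_mult_le: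
  fixes A B :: "'a::euclidean_space set" and s :: "'a \<Rightarrow> 'a" and \<psi> :: "'a \<Rightarrow> real"
  assumes "compact A" "compact B" "ahlfors_david_regular A" "ahlfors_david_regular B"
    and "local_smooth_diffeo s" "continuous_on UNIV \<psi>" "compact (closure {x. \<psi> x \<noteq> 0})" "\<epsilon>0 > 0"
  shows "\<exists>C. \<forall>\<epsilon>. 0 < \<epsilon> \<and> \<epsilon> \<le> \<epsilon>0 \<longrightarrow>
    integrable lborel (\<lambda>x. real (covering_number (A \<inter> {s x - b | b. b \<in> B}) \<epsilon>) * \<psi> x) \<and>
    (LINT x|lborel. real (covering_number (A \<inter> {s x - b | b. b \<in> B}) \<epsilon>) * \<psi> x)
      \<le> C * inverse \<epsilon> powr (hausdorff_dim A + hausdorff_dim B - real DIM('a))"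
proof -
  define t where "t = hausdorff_dim A + hausdorff_dim B - real DIM('a)"
  define N where "N = (\<lambda>\<epsilon> x. real (covering_number (A \<inter> {s x - b | b. b \<in> B}) \<epsilon>))"
  define K where "K = closure {x. \<psi> x \<noteq> 0}"
  have "compact (\<psi> ` K)"
    using assms(6,7) unfolding K_def by (intro compact_continuous_image) (auto intro: continuous_on_subset)
  then obtain M where M: "\<And>x. x \<in> K \<Longrightarrow> \<bar>\<psi> x\<bar> \<le> M"
    using compact_imp_bounded bounded_iff by (metis image_eqI real_norm_def)
  \<comment> \<open>If \<open>K\<close> is empty, \<open>M\<close> is unconstrained and may be
    negative.\<close>
  define M' where "M' = max 0 M"
  have M': "M' \<ge> 0" "\<bar>\<psi> x\<bar> \<le> M' * indicator K x" for x
  proof -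
    show "M' \<ge> 0" by (simp add: M'_def)
    show "\<bar>\<psi> x\<bar> \<le> M' * indicator K x"
    proof (cases "x \<in> K")
      case True
      then show ?thesis using M[OF True] by (simp add: M'_def)
    next
      case False
      then have "\<psi> x = 0" using closure_subset[of "{x. \<psi> x \<noteq> 0}"] unfolding K_def by blast
      then show ?thesis using False by simp
    qed
  qed
  obtain C where C: "C \<ge> 0" "\<forall>\<epsilon>\<in>{0<..\<epsilon>0}.
      (\<integral>\<^sup>+x. ennreal (N \<epsilon> x) * indicator K x \<partial>lborel) \<le> ennreal (C * inverse \<epsilon> powr t)"
    using nn_integral_covering_number_le[OF assms(1-5,7,8)]
    unfolding N_def t_def K_def by (elim exE conjE)
  have "integrable lborel (\<lambda>x. N \<epsilon> x * \<psi> x) \<and> (LINT x|lborel. N \<epsilon> x * \<psi> x) \<le> (M' * C) * inverse \<epsilon> powr t"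
    if \<epsilon>: "0 < \<epsilon>" "\<epsilon> \<le> \<epsilon>0" for \<epsilon>
  proof -
    have meas[measurable]: "N \<epsilon> \<in> borel_measurable borel"
      using borel_measurable_covering_number[OF assms(1,2) local_smooth_diffeo_continuous[OF assms(5)] \<epsilon>(1)]
      unfolding N_def .
    have [measurable]: "\<psi> \<in> borel_measurable borel"
      using assms(6) by (rule borel_measurable_continuous_onI)
    have [measurable]: "K \<in> sets borel" unfolding K_def by simp
    have "(\<integral>\<^sup>+x. ennreal (norm (N \<epsilon> x * \<psi> x)) \<partial>lborel)
        \<le> (\<integral>\<^sup>+x. ennreal M' * (ennreal (N \<epsilon> x) * indicator K x) \<partial>lborel)"
    proof (rule nn_integral_mono)
      fix x
      have "norm (N \<epsilon> x * \<psi> x) \<le> N \<epsilon> x * (M' * indicator K x)"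
        using mult_left_mono[OF M'(2)[of x], of "N \<epsilon> x"] by (simp add: N_def abs_mult)
      then have "ennreal (norm (N \<epsilon> x * \<psi> x)) \<le> ennreal (N \<epsilon> x * (M' * indicator K x))"
        by (rule ennreal_leI)
      also have "\<dots> = ennreal M' * (ennreal (N \<epsilon> x) * indicator K x)"
        using M'(1) by (cases "x \<in> K") (simp_all add: N_def ennreal_mult mult.commute)
      finally show "ennreal (norm (N \<epsilon> x * \<psi> x)) \<le> ennreal M' * (ennreal (N \<epsilon> x) * indicator K x)" .
    qed
    also have "\<dots> = ennreal M' * (\<integral>\<^sup>+x. ennreal (N \<epsilon> x) * indicator K x \<partial>lborel)"
      by (intro nn_integral_cmult) measurable
    also have "\<dots> \<le> ennreal M' * ennreal (C * inverse \<epsilon> powr t)"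
      using C(2) \<epsilon> by (intro mult_left_mono) auto
    also have "\<dots> = ennreal ((M' * C) * inverse \<epsilon> powr t)"
      using M'(1) C(1) by (simp add: mult.assoc flip: ennreal_mult)
    finally have bound: "(\<integral>\<^sup>+x. ennreal (norm (N \<epsilon> x * \<psi> x)) \<partial>lborel) \<le> ennreal ((M' * C) * inverse \<epsilon> powr t)" .
    have int: "integrable lborel (\<lambda>x. N \<epsilon> x * \<psi> x)"
    proof (rule integrableI_bounded)
      show "(\<integral>\<^sup>+x. ennreal (norm (N \<epsilon> x * \<psi> x)) \<partial>lborel) < \<infinity>"
        using bound by (rule le_less_trans) simp
    qed measurable
    have "ennreal (norm (LINT x|lborel. N \<epsilon> x * \<psi> x)) \<le> ennreal ((M' * C) * inverse \<epsilon> powr t)"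
      using integral_norm_bound_ennreal[OF int] bound by (rule order_trans)
    then have "norm (LINT x|lborel. N \<epsilon> x * \<psi> x) \<le> (M' * C) * inverse \<epsilon> powr t"
      using M'(1) C(1) by (subst (asm) ennreal_le_iff) simp_all
    with int show ?thesis by auto
  qed
  then show ?thesis unfolding N_def t_def by blast
qed

theorem theorem2p2:
  fixes A B :: "(real ^ 'n) set" and s :: "real ^ 'n \<Rightarrow> real ^ 'n" and s\<^sub>A s\<^sub>B :: real
  assumes "CARD('n) \<ge> 2"
    and "compact A" and "compact B"
    and "ahlfors_david_regular A" and "ahlfors_david_regular B"
    and "hausdorff_dim A = s\<^sub>A" and "hausdorff_dim B = s\<^sub>B"
    and "s\<^sub>A + s\<^sub>B \<ge> real CARD('n)"
    and "local_smooth_diffeo s"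
  shows "(\<forall>\<psi> :: real ^ 'n \<Rightarrow> real. smooth_on \<psi> UNIV \<longrightarrow> compact (closure {x. \<psi> x \<noteq> 0}) \<longrightarrow>
           (\<forall>\<epsilon>\<^sub>0>0. \<exists>C. \<forall>\<epsilon>. 0 < \<epsilon> \<and> \<epsilon> \<le> \<epsilon>\<^sub>0 \<longrightarrow>
              integrable lborel (\<lambda>x. real (covering_number (A \<inter> {s x - b | b. b \<in> B}) \<epsilon>) * \<psi> x) \<and>
              (LINT x|lborel. real (covering_number (A \<inter> {s x - b | b. b \<in> B}) \<epsilon>) * \<psi> x)
                \<le> C * inverse \<epsilon> powr (s\<^sub>A + s\<^sub>B - real CARD('n)))) \<and>
         (AE x in lborel. lower_minkowski_dim (A \<inter> {s x - b | b. b \<in> B})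
            \<le> ereal (s\<^sub>A + s\<^sub>B - real CARD('n)))"
proof (intro conjI allI impI)
  have dim: "s\<^sub>A + s\<^sub>B - real CARD('n) = hausdorff_dim A + hausdorff_dim B - real DIM(real ^ 'n)"
    using assms(6,7) by simp
  show "AE x in lborel. lower_minkowski_dim (A \<inter> {s x - b | b. b \<in> B})
      \<le> ereal (s\<^sub>A + s\<^sub>B - real CARD('n))"
    unfolding dim using assms by (intro AE_lower_minkowski_dim_le) simp_all
  fix \<psi> :: "real ^ 'n \<Rightarrow> real" and \<epsilon>\<^sub>0 :: real
  assume "smooth_on \<psi> UNIV" "compact (closure {x. \<psi> x \<noteq> 0})" "\<epsilon>\<^sub>0 > 0"
  moreover have "continuous_on UNIV \<psi>"
    using \<open>smooth_on \<psi> UNIV\<close> unfolding smooth_on_def by (metis Ck_on.simps(1))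
  ultimately show "\<exists>C. \<forall>\<epsilon>. 0 < \<epsilon> \<and> \<epsilon> \<le> \<epsilon>\<^sub>0 \<longrightarrow>
              integrable lborel (\<lambda>x. real (covering_number (A \<inter> {s x - b | b. b \<in> B}) \<epsilon>) * \<psi> x) \<and>
              (LINT x|lborel. real (covering_number (A \<inter> {s x - b | b. b \<in> B}) \<epsilon>) * \<psi> x)
                \<le> C * inverse \<epsilon> powr (s\<^sub>A + s\<^sub>B - real CARD('n))"
    unfolding dim using assms(2-5,9) by (intro integral_covering_number_mult_le)
qed

end
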